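(* Let $q$ be a power of an odd prime $p$, let $c$ be an indeterminate, and let $x=c^2/(1-c)^3$. Then in the polynomial ring $\mathbb{Z}[c]$ we have $$2(2+c)(1-c)^{q-1}\sum_{0\le k<q/3}\binom{3k}{k}x^k\equiv 1+3(1-4c)^{(q-1)/2}+2c^q\pmod{p},$$ and $$2(2+c)(1-c)^{2q-1}\sum_{0\le k<2q/3}\binom{3k}{k}x^k\equiv 1+3(1-4c)^{(q-1)/2}-2c^q-2c^{2q}\pmod{p}.$$
   Context: Here $q=p^f$ with $f\ge 1$, and the sums are over integers $k$ in the indicated ranges. Although $x$ is a rational function of $c$, the left-hand sides are polynomials in $\mathbb{Z}[c]$, since $(1-c)^{mq-1}x^k=c^{2k}(1-c)^{mq-1-3k}$ with $mq-1-3k\ge 0$ for $k<mq/3$ ($m=1,2$). The congruences modulo $p$ mean that the difference of the two sides lies in $p\,\mathbb{Z}[c]$. *)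

theory Defs
  imports "HOL-Computational_Algebra.Computational_Algebra"
begin

text \<open>
  Rational functions in one indeterminate are elements of \<open>int poly fract\<close>, the fraction field of
  \<open>\<int>[c]\<close>. The congruence below includes the claim that both sides lie in \<open>\<int>[c]\<close>. The polynomials
  \<open>P\<close> and \<open>Q\<close> are unique because \<open>to_fract\<close> is injective; divisibility is taken in \<open>\<int>[c]\<close>, i.e.
  \<open>P - Q \<in> p\<int>[c]\<close>.
\<close>

definition poly_cong :: "nat \<Rightarrow> int poly fract \<Rightarrow> int poly fract \<Rightarrow> bool" where
  "poly_cong p F G \<longleftrightarrow>
     (\<exists>P Q :: int poly. F = to_fract P \<and> G = to_fract Q \<and> [:int p:] dvd P - Q)"

definition indet :: "int poly fract" where
  "indet = to_fract [:0, 1:]"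

end

theory Submission
  imports Defs "HOL-Number_Theory.Residues"
begin

text \<open>
  Put \<open>S = \<Sum>k (3k choose k) c^(2k) (1-c)^(mq-1-3k)\<close> over \<open>3k < mq\<close>, with \<open>m \<in> {1, 2}\<close>. Modulo \<open>p\<close> we have
  \<open>(1-c)^(mq) = (1-c^q)^m\<close>, and the binomial coefficients with \<open>mq \<le> 3k\<close>, \<open>2k < mq\<close> vanish. Hence
  \<open>2(2+c)S\<close> agrees modulo \<open>p\<close> and \<open>c^(mq)\<close> with \<open>(1-c^q)^m\<close> times the full power series
  \<open>2(2+c)/(1-c) \<Sum>k (3k choose k) x^k = 1 + 3(1-4c)^(-1/2)\<close>. On the other side,
  \<open>(1-4c)^(-1/2) = (1-4c)^((q-1)/2) (1+2c^q)\<close> modulo \<open>p\<close> and \<open>c^(2q)\<close>, since both have the same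
  square and their sum is a unit. Both sides of the claim have degree at most \<open>mq\<close>, so only the
  coefficient of \<open>c^(mq)\<close> remains, and it is determined by evaluating at \<open>c = -2\<close>.
\<close>

section \<open>Congruence of integer power series modulo p and a power of X\<close>

text \<open>Congruence in \<open>Z[[X]]\<close> modulo the ideal generated by \<open>p\<close> and
  \<open>X^N\<close>, hence compatible with sums and products.\<close>

definition fps_cong :: "int \<Rightarrow> nat \<Rightarrow> int fps \<Rightarrow> int fps \<Rightarrow> bool" where
  "fps_cong p N f g \<longleftrightarrow> (\<forall>n<N. [fps_nth f n = fps_nth g n] (mod p))"

lemma fps_cong_refl [simp]: "fps_cong p N f f"
  by (simp add: fps_cong_def)

lemma fps_cong_sym: "fps_cong p N f g \<Longrightarrow> fps_cong p N g f"
  by (auto simp: fps_cong_def cong_sym)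

lemma fps_cong_trans [trans]: "fps_cong p N f g \<Longrightarrow> fps_cong p N g h \<Longrightarrow> fps_cong p N f h"
  by (auto simp: fps_cong_def intro: cong_trans)

lemma fps_cong_eq_trans [trans]:
  "f = g \<Longrightarrow> fps_cong p N g h \<Longrightarrow> fps_cong p N f h"
  "fps_cong p N f g \<Longrightarrow> g = h \<Longrightarrow> fps_cong p N f h"
  by auto

lemma fps_cong_mono: "fps_cong p N f g \<Longrightarrow> M \<le> N \<Longrightarrow> fps_cong p M f g"
  by (auto simp: fps_cong_def)

lemma fps_cong_add: "fps_cong p N f g \<Longrightarrow> fps_cong p N f' g' \<Longrightarrow> fps_cong p N (f + f') (g + g')"
  by (auto simp: fps_cong_def intro: cong_add)

lemma fps_cong_sum: "(\<And>i. i \<in> I \<Longrightarrow> fps_cong p N (f i) (g i)) \<Longrightarrow> fps_cong p N (sum f I) (sum g I)"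
  by (induction I rule: infinite_finite_induct) (auto intro: fps_cong_add)

lemma fps_cong_mult: "fps_cong p N f g \<Longrightarrow> fps_cong p N f' g' \<Longrightarrow> fps_cong p N (f * f') (g * g')"
  unfolding fps_cong_def fps_mult_nth by (auto intro!: cong_sum cong_mult)

lemma fps_cong_power: "fps_cong p N f g \<Longrightarrow> fps_cong p N (f ^ k) (g ^ k)"
  by (induction k) (auto intro: fps_cong_mult)

lemma fps_cong_iff_diff: "fps_cong p N f g \<longleftrightarrow> fps_cong p N (f - g) 0"
  by (simp add: fps_cong_def cong_iff_dvd_diff)

lemma fps_cong_X_power_mult: "N \<le> k \<Longrightarrow> fps_cong p N (fps_X ^ k * f) 0"
  by (simp add: fps_cong_def fps_X_power_mult_nth)

text \<open>A series whose constant term is coprime to \<open>p\<close> is a unit modulo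
  \<open>p\<close> and \<open>X^N\<close>. Concretely, coefficient \<open>n\<close> of
  \<open>u * d\<close> is \<open>u $ 0 * d $ n\<close> plus multiples of earlier coefficients of
  \<open>d\<close>, which are already known to be divisible by \<open>p\<close>.\<close>

lemma fps_cong_mult_cancel_left:
  assumes "fps_cong p N (u * d) 0" and "coprime (fps_nth u 0) p"
  shows "fps_cong p N d 0"
proof -
  have "p dvd fps_nth d n" if "n < N" for n
    using that
  proof (induction n rule: less_induct)
    case (less n)
    have "(u * d) $ n = (\<Sum>i=0..n. u $ i * d $ (n - i))"
      by (rule fps_mult_nth)
    also have "\<dots> = u $ 0 * d $ n + (\<Sum>i=1..n. u $ i * d $ (n - i))"
      by (simp add: sum.atLeast_Suc_atMost)
    finally have eq: "u $ 0 * d $ n = (u * d) $ n - (\<Sum>i=1..n. u $ i * d $ (n - i))"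
      by simp
    have "p dvd (u * d) $ n"
      using assms(1) less.prems by (simp add: fps_cong_def cong_0_iff)
    moreover have "p dvd (\<Sum>i=1..n. u $ i * d $ (n - i))"
      using less by (intro dvd_sum dvd_mult) auto
    ultimately have "p dvd u $ 0 * d $ n"
      unfolding eq by (rule dvd_diff)
    then show ?case
      using assms(2) by (simp add: coprime_commute coprime_dvd_mult_right_iff)
  qed
  then show ?thesis
    by (simp add: fps_cong_def cong_0_iff)
qed

section \<open>Binomial coefficients and prime powers modulo p\<close>

lemma fps_nth_linear_power:
  fixes a :: "'a::comm_ring_1"
  shows "fps_nth ((1 + fps_const a * fps_X) ^ n) k = of_nat (n choose k) * a ^ k"
proof (induction n arbitrary: k)
  case 0
  then show ?case by (cases k) auto
next
  case (Suc n)
  have "(1 + fps_const a * fps_X) ^ Suc n =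
    (1 + fps_const a * fps_X) ^ n + fps_const a * (fps_X * (1 + fps_const a * fps_X) ^ n)"
    by (simp add: algebra_simps)
  then show ?case
    using Suc by (cases k) (simp_all add: algebra_simps)
qed

text \<open>Absorption writes \<open>k * (p ^ f choose k)\<close> as a multiple of
  \<open>p ^ f\<close>. If \<open>p\<close> did not divide the binomial coefficient,
  \<open>p ^ f\<close> would have to divide the smaller positive number \<open>k\<close>.\<close>

lemma prime_dvd_choose_prime_power:
  fixes p :: nat
  assumes "prime p" "0 < k" "k < p ^ f"
  shows "p dvd (p ^ f choose k)"
proof (rule ccontr)
  assume "\<not> p dvd (p ^ f choose k)"
  then have "coprime (p ^ f) (p ^ f choose k)"
    using assms(1) by (simp add: prime_imp_coprime)
  moreover have "p ^ f dvd k * (p ^ f choose k)"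
    using times_binomial_minus1_eq[OF assms(2), of "p ^ f"] by simp
  ultimately have "p ^ f dvd k"
    by (simp add: coprime_dvd_mult_left_iff)
  then show False
    using assms by (auto dest: dvd_imp_le)
qed

lemma fermat_prime_power:
  assumes "prime p"
  shows "[a ^ (p ^ f) = a] (mod int p)"
proof (induction f)
  case (Suc f)
  have fermat: "[c ^ p = c] (mod p)" for c
  proof (cases "p dvd c")
    case True
    then have "p dvd c ^ p"
      using assms by (simp add: prime_dvd_power_iff prime_gt_0_nat)
    with True show ?thesis
      by (simp add: cong_def)
  next
    case False
    have "[c * c ^ (p - 1) = c * 1] (mod p)"
      by (rule cong_scalar_left[OF fermat_theorem[OF assms False]])
    moreover have "c * c ^ (p - 1) = c ^ p"
      using assms by (simp add: prime_gt_0_nat flip: power_Suc)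
    ultimately show ?thesis by simp
  qed
  \<comment> \<open>Fermat's theorem is applied to natural numbers, so the integer \<open>a\<close>
    is replaced by its least nonnegative residue.\<close>
  let ?c = "nat (a mod int p)"
  have "int ?c = a mod int p"
    using assms by (simp add: prime_gt_0_nat)
  then have c: "[a = int ?c] (mod int p)"
    by (simp add: cong_def)
  have "[int (?c ^ p) = int ?c] (mod int p)"
    using fermat[of ?c] by (simp only: cong_int_iff)
  then have "[a ^ p = a] (mod int p)"
    using cong_trans[OF cong_pow[OF c, of p]] cong_sym[OF c] cong_trans
    unfolding of_nat_power by blast
  then have "[(a ^ p) ^ p ^ f = a ^ p ^ f] (mod int p)"
    by (rule cong_pow)
  also note Suc
  finally show ?case
    by (simp add: power_mult)
qed simp

text \<open>The Frobenius map on linear series: the inner binomial coefficients vanish modulo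
  \<open>p\<close>, and the top coefficient \<open>a ^ (p ^ f)\<close> reduces to \<open>a\<close>.
  All coefficients agree, so the precision \<open>N\<close> is arbitrary.\<close>

lemma fps_cong_linear_prime_power:
  assumes "prime p"
  shows "fps_cong (int p) N ((1 + fps_const a * fps_X) ^ (p ^ f)) (1 + fps_const a * fps_X ^ (p ^ f))"
proof -
  have "[int (p ^ f choose n) * a ^ n = (1 + fps_const a * fps_X ^ (p ^ f)) $ n] (mod int p)" for n
  proof -
    consider "n = 0" | "n = p ^ f" | "0 < n" "n < p ^ f" | "n > p ^ f"
      by linarith
    then show ?thesis
    proof cases
      case 2
      then show ?thesis
        using fermat_prime_power[OF assms] assms by (auto simp: prime_gt_0_nat)
    next
      case 3
      then have "int p dvd int (p ^ f choose n)"
        using prime_dvd_choose_prime_power[OF assms] by (simp add: int_dvd_int_iff)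
      then show ?thesis
        using 3 by (simp add: cong_0_iff)
    qed (use assms in \<open>auto simp: prime_gt_0_nat binomial_eq_0\<close>)
  qed
  then show ?thesis
    by (simp add: fps_cong_def fps_nth_linear_power)
qed

text \<open>A case of Lucas' theorem: modulo \<open>p\<close> and \<open>X^q\<close> with
  \<open>q = p ^ f\<close>, the factor \<open>(1+X)^(mq)\<close> is 1. Coefficient
  \<open>k < q\<close> of \<open>(1+X)^(mq+r)\<close> is therefore congruent to
  \<open>r choose k\<close>, which is 0.\<close>

lemma prime_dvd_choose_of_remainder_less:
  assumes "prime p" "r < k" "k < p ^ f"
  shows "p dvd ((m * p ^ f + r) choose k)"
proof -
  let ?l = "1 + fps_const 1 * fps_X :: int fps"
  have "fps_cong (int p) (p ^ f) (?l ^ (p ^ f)) (1 + fps_const 1 * fps_X ^ (p ^ f))"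
    by (rule fps_cong_linear_prime_power[OF assms(1)])
  also have "fps_cong (int p) (p ^ f) (1 + fps_const 1 * fps_X ^ (p ^ f)) (1 + 0)"
    using fps_cong_add[OF fps_cong_refl fps_cong_X_power_mult[of "p ^ f" "p ^ f" "int p" 1], of 1] 
    by simp
  finally have "fps_cong (int p) (p ^ f) ((?l ^ (p ^ f)) ^ m * ?l ^ r) ((1 + 0) ^ m * ?l ^ r)"
    by (intro fps_cong_mult fps_cong_power fps_cong_refl)
  then have "fps_cong (int p) (p ^ f) (?l ^ (m * p ^ f + r)) (?l ^ r)"
    by (simp add: power_add mult.commute[of m] power_mult)
  then have "[(?l ^ (m * p ^ f + r)) $ k = (?l ^ r) $ k] (mod int p)"
    using assms by (simp add: fps_cong_def)
  then have "[int ((m * p ^ f + r) choose k) = int (r choose k)] (mod int p)"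
    by (simp only: fps_nth_linear_power power_one mult_1_right)
  then have "int p dvd int ((m * p ^ f + r) choose k)"
    using assms(2) by (simp add: cong_0_iff binomial_eq_0)
  then show ?thesis
    by (simp add: int_dvd_int_iff)
qed

section \<open>Negative binomial series and the coefficient recurrence\<close>

text \<open>This is \<open>1/(1-X^d)^(m+1)\<close>, given by its coefficients.\<close>

definition geom_fps :: "nat \<Rightarrow> nat \<Rightarrow> int fps" where
  "geom_fps d m = Abs_fps (\<lambda>n. if d dvd n then int ((m + n div d) choose m) else 0)"

text \<open>Multiplying by \<open>1 - X^d\<close> takes differences of coefficients at distance
  \<open>d\<close>; Pascal's rule turns these into the coefficients for the next smaller
  \<open>m\<close>.\<close>

lemma geom_fps_mult:
  assumes "d > 0"
  shows "(1 - fps_X ^ d) ^ Suc m * geom_fps d m = 1"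
proof (induction m)
  case 0
  have "(1 - fps_X ^ d) * geom_fps d 0 = 1"
  proof (rule fps_ext)
    fix n
    have "((1 - fps_X ^ d) * geom_fps d 0) $ n = geom_fps d 0 $ n - (fps_X ^ d * geom_fps d 0) $ n"
      by (simp add: algebra_simps)
    also have "\<dots> = 1 $ n"
      using assms by (auto simp: geom_fps_def fps_X_power_mult_nth dvd_minus_self dest: dvd_imp_le)
    finally show "((1 - fps_X ^ d) * geom_fps d 0) $ n = 1 $ n" .
  qed
  then show ?case by simp
next
  case (Suc m)
  have "(1 - fps_X ^ d) * geom_fps d (Suc m) = geom_fps d m"
  proof (rule fps_ext)
    fix n
    have eq: "((1 - fps_X ^ d) * geom_fps d (Suc m)) $ n =
        geom_fps d (Suc m) $ n - (fps_X ^ d * geom_fps d (Suc m)) $ n"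
      by (simp add: algebra_simps)
    show "((1 - fps_X ^ d) * geom_fps d (Suc m)) $ n = geom_fps d m $ n"
    proof (cases "n < d")
      case True
      then show ?thesis
        using assms unfolding eq
        by (cases "n = 0") (auto simp: geom_fps_def fps_X_power_mult_nth dest: dvd_imp_le)
    next
      case False
      show ?thesis
      proof (cases "d dvd n")
        case True
        then obtain j where j: "n = d * Suc j"
          using False assms by (metis dvdE gr0_conv_Suc less_nat_zero_code mult_0_right neq0_conv)
        have "n - d = d * j" using j by simp
        then show ?thesis
          unfolding eq using assms by (simp add: geom_fps_def fps_X_power_mult_nth j del: mult_Suc_right)
      next
        case ndvd: False
        then show ?thesis
          unfolding eq using False by (simp add: geom_fps_def fps_X_power_mult_nth dvd_minus_self)
      qed
    qed
  qed
  then have "(1 - fps_X ^ d) ^ Suc (Suc m) * geom_fps d (Suc m) = (1 - fps_X ^ d) ^ Suc m * geom_fps d m"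
    by (simp only: power_Suc2[of _ "Suc m"] mult.assoc)
  then show ?case using Suc by (simp only:)
qed

lemma sum_even_atMost:
  fixes g :: "nat \<Rightarrow> 'a::comm_monoid_add"
  shows "(\<Sum>i=0..n. if even i then g (i div 2) else 0) = (\<Sum>k | 2 * k \<le> n. g k)"
proof -
  have "(\<Sum>i=0..n. if even i then g (i div 2) else 0) = (\<Sum>i\<in>{i\<in>{0..n}. even i}. g (i div 2))"
    by (rule sum.inter_filter[symmetric]) simp
  also have "\<dots> = (\<Sum>k | 2 * k \<le> n. g k)"
    by (rule sum.reindex_bij_witness[of _ "\<lambda>k. 2 * k" "\<lambda>i. i div 2"]) auto
  finally show ?thesis .
qed

text \<open>
  The sum is the coefficient of \<open>X^n\<close> in \<open>(1+X)^n / (1-X^2)^(n+1) = 1 / ((1-X)^(n+1) (1+X))\<close>, and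
  \<open>4 + 2X(1-X) = (1+X)(4-2X)\<close> removes the factor \<open>1+X\<close> in the denominator.
\<close>

lemma sum_choose_choose_recurrence:
  fixes a :: "nat \<Rightarrow> int"
  defines "a \<equiv> \<lambda>n. \<Sum>k | 2 * k \<le> n. int ((n choose (2 * k)) * ((n + k) choose k))"
  shows "4 * a (Suc n) + 2 * a n = 3 * int ((2 * Suc n) choose Suc n)"
proof -
  define A where "A n = geom_fps 2 n * (1 + fps_const 1 * fps_X) ^ n" for n
  have a_eq: "a n = A n $ n" for n
  proof -
    have "A n $ n = (\<Sum>i=0..n. if even i then
        int ((n + i div 2) choose n) * int (n choose (n - 2 * (i div 2))) else 0)"
      unfolding A_def fps_mult_nth fps_nth_linear_power
      by (rule sum.cong) (auto simp: geom_fps_def)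
    also have "\<dots> = (\<Sum>k | 2 * k \<le> n. int ((n + k) choose n) * int (n choose (n - 2 * k)))"
      by (rule sum_even_atMost)
    also have "\<dots> = a n"
      unfolding a_def
    proof (rule sum.cong)
      fix k assume "k \<in> {k. 2 * k \<le> n}"
      then have "(n + k) choose n = (n + k) choose k" "n choose (n - 2 * k) = n choose (2 * k)"
        using binomial_symmetric[of n "n + k"] binomial_symmetric[of "2 * k" n] by auto
      then show "int ((n + k) choose n) * int (n choose (n - 2 * k)) =
          int ((n choose (2 * k)) * ((n + k) choose k))"
        by simp
    qed simp
    finally show ?thesis by simp
  qed
  have A: "(1 - fps_X) ^ Suc n * ((1 + fps_X) * A n) = 1" for n
  proof -
    have "(1 - fps_X) ^ Suc n * ((1 + fps_X) * A n) = ((1 - fps_X) * (1 + fps_X)) ^ Suc n * geom_fps 2 n"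
      unfolding A_def power_mult_distrib by (simp add: mult_ac)
    also have "(1 - fps_X) * (1 + fps_X) = (1 - fps_X ^ 2 :: int fps)"
      by (simp add: algebra_simps power2_eq_square)
    also have "\<dots> ^ Suc n * geom_fps 2 n = 1"
      by (rule geom_fps_mult) simp
    finally show ?thesis .
  qed
  have ring1: "d * P * s * (4 * B + 2 * (x * C)) = 4 * (d * P * (s * B)) + 2 * x * d * (P * (s * C))"
    and ring2: "P * B * ((4 - 2 * x) * s) = P * s * (4 * B - 2 * (x * B))"
    for d P s B x C :: "int fps"
    by (simp_all only: distrib_left left_diff_distrib right_diff_distrib mult_ac)
  \<comment> \<open>The factor \<open>?u\<close> clears the denominators of both
    \<open>A (Suc n)\<close> and \<open>X * A n\<close>.\<close>
  let ?u = "(1 - fps_X) ^ Suc (Suc n) * (1 + fps_X) :: int fps"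
  have "?u * (4 * A (Suc n) + 2 * (fps_X * A n)) =
      4 * ((1 - fps_X) ^ Suc (Suc n) * ((1 + fps_X) * A (Suc n)))
      + 2 * fps_X * (1 - fps_X) * ((1 - fps_X) ^ Suc n * ((1 + fps_X) * A n))"
    unfolding power_Suc[of _ "Suc n"] by (rule ring1)
  also have "\<dots> = (4 - 2 * fps_X) * (1 + fps_X)"
    unfolding A by (simp add: algebra_simps)
  \<comment> \<open>Inserting \<open>(1-X)^(n+2)\<close> times its inverse exhibits the right side
    as a multiple of \<open>?u\<close>, which can then be cancelled.\<close>
  also have "\<dots> = ((1 - fps_X ^ 1) ^ Suc (Suc n) * geom_fps 1 (Suc n)) * ((4 - 2 * fps_X) * (1 + fps_X))"
    by (subst geom_fps_mult) simp_all
  also have "\<dots> = ?u * (4 * geom_fps 1 (Suc n) - 2 * (fps_X * geom_fps 1 (Suc n)))"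
    unfolding power_one_right by (rule ring2)
  finally have eq: "4 * A (Suc n) + 2 * (fps_X * A n)
      = 4 * geom_fps 1 (Suc n) - 2 * (fps_X * geom_fps 1 (Suc n))"
  proof (rule mult_left_cancel[THEN iffD1, rotated])
    have "?u $ 0 \<noteq> 0" by (simp add: fps_nth_power_0)
    then show "?u \<noteq> 0" by (metis fps_zero_nth)
  qed
  have nth: "(4 * F + 2 * (fps_X * G)) $ Suc n = 4 * F $ Suc n + 2 * G $ n"
    "(4 * F - 2 * (fps_X * G)) $ Suc n = 4 * F $ Suc n - 2 * G $ n" for F G :: "int fps"
    by (simp_all add: numeral_fps_const)
  have "4 * a (Suc n) + 2 * a n = 4 * geom_fps 1 (Suc n) $ Suc n - 2 * geom_fps 1 (Suc n) $ n"
    using arg_cong[OF eq, of "\<lambda>F. F $ Suc n"] unfolding nth a_eq .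
  also have "\<dots> = 4 * int (Suc n + Suc n choose Suc n) - 2 * int (Suc n + n choose Suc n)"
    by (simp only: geom_fps_def fps_nth_Abs_fps one_dvd if_True div_by_1)
  \<comment> \<open>With \<open>B = (2n+1 choose n+1)\<close>, the central coefficient is
    \<open>2B\<close>, so \<open>4 * 2B - 2B = 3 * 2B\<close>.\<close>
  also have "Suc n + Suc n choose Suc n = 2 * (Suc n + n choose Suc n)"
    using binomial_symmetric[of n "Suc n + n"] by simp
  also have "4 * int (2 * (Suc n + n choose Suc n)) - 2 * int (Suc n + n choose Suc n)
      = 3 * int (2 * (Suc n + n choose Suc n))"
    by simp
  also have "2 * (Suc n + n choose Suc n) = (2 * Suc n) choose Suc n"
    using binomial_symmetric[of n "Suc n + n"] by (simp add: mult_2)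
  finally show ?thesis .
qed

section \<open>The central binomial series and its reduction modulo p\<close>

text \<open>The expansion of \<open>(1-4X)^(-1/2)\<close>.\<close>

definition central_fps :: "int fps" where
  "central_fps = Abs_fps (\<lambda>n. int ((2 * n) choose n))"

text \<open>The ratio of consecutive central binomial coefficients amounts to the differential
  equation \<open>(1-4X) y' = 2y\<close>. Hence \<open>(1-4X) y^2\<close> has derivative 0 and
  equals its constant term 1.\<close>

lemma central_fps_square: "(1 - 4 * fps_X) * central_fps ^ 2 = 1"
proof -
  have rec: "Suc n * ((2 * Suc n) choose Suc n) = 2 * (2 * n + 1) * ((2 * n) choose n)" for n
  proof -
    have "Suc n * ((2 * Suc n) choose Suc n) = 2 * Suc n * (Suc (2 * n) choose n)"
      using Suc_times_binomial[of n "Suc (2 * n)"] by simp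
    also have "Suc (2 * n) choose n = Suc (2 * n) choose Suc n"
      using binomial_symmetric[of n "Suc (2 * n)"] by simp
    also have "2 * Suc n * \<dots> = 2 * (2 * n + 1) * ((2 * n) choose n)"
      using Suc_times_binomial[of n "2 * n"] by (simp only: mult.assoc) simp
    finally show ?thesis .
  qed
  have num: "(numeral w * F) $ k = numeral w * F $ k" for w k and F :: "int fps"
    by (simp add: numeral_fps_const)
  have ode: "(1 - 4 * fps_X) * fps_deriv central_fps = 2 * central_fps"
  proof (rule fps_ext)
    fix n
    have rec': "int (Suc n) * central_fps $ Suc n = 2 * (2 * int n + 1) * central_fps $ n" for n
      using arg_cong[OF rec[of n], of int] unfolding central_fps_def fps_nth_Abs_fps
      by (simp only: of_nat_mult of_nat_add of_nat_1 of_nat_numeral)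
    have "((1 - 4 * fps_X) * fps_deriv central_fps) $ n
        = fps_deriv central_fps $ n - 4 * (fps_X * fps_deriv central_fps) $ n"
      by (simp only: left_diff_distrib fps_sub_nth mult.assoc num) simp
    also have "\<dots> = 2 * central_fps $ n"
      using rec'[of n] by (cases n) (simp_all add: algebra_simps)
    finally show "((1 - 4 * fps_X) * fps_deriv central_fps) $ n = (2 * central_fps) $ n"
      by (simp only: num)
  qed
  have "fps_deriv ((1 - 4 * fps_X) * central_fps ^ 2) =
      2 * central_fps * ((1 - 4 * fps_X) * fps_deriv central_fps) - 4 * central_fps ^ 2"
    by (simp add: power2_eq_square algebra_simps)
  also have "\<dots> = 0"
    unfolding ode by (simp add: power2_eq_square)
  finally have "(1 - 4 * fps_X) * central_fps ^ 2 = fps_const (((1 - 4 * fps_X) * central_fps ^ 2) $ 0)"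
    by (rule iffD1[OF fps_deriv_eq_0_iff])
  then show ?thesis
    by (simp add: central_fps_def fps_nth_power_0)
qed

lemma central_fps_cong:
  fixes p f :: nat
  assumes "prime p" "odd p"
  defines "q \<equiv> p ^ f"
  shows "fps_cong (int p) (2 * q) central_fps
    ((1 - 4 * fps_X) ^ ((q - 1) div 2) * (1 + 2 * fps_X ^ q))"
proof -
  define u :: "int fps" where "u = 1 - 4 * fps_X"
  define x :: "int fps" where "x = fps_X ^ q"
  \<comment> \<open>\<open>1 + 2x\<close> is the expansion of \<open>(1-4x)^(-1/2)\<close> cut off
    after the linear term; hence \<open>(1-4x)(1+2x)^2\<close> is 1 up to a multiple of
    \<open>x^2 = X^(2q)\<close>.\<close>
  define Y where "Y = u ^ ((q - 1) div 2) * (1 + 2 * x)"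
  have "odd q" "q > 0"
    using assms by (auto simp: prime_gt_0_nat)
  have u: "u = 1 + fps_const (- 4) * fps_X"
    by (simp add: u_def numeral_fps_const flip: fps_const_neg)
  have "fps_cong (int p) (2 * q) (u ^ q) (1 + fps_const (- 4) * fps_X ^ q)"
    unfolding u q_def by (rule fps_cong_linear_prime_power[OF assms(1)])
  also have "1 + fps_const (- 4) * fps_X ^ q = 1 - 4 * x"
    by (simp add: x_def numeral_fps_const flip: fps_const_neg)
  finally have "fps_cong (int p) (2 * q) (u ^ q * (1 + 2 * x)\<^sup>2) ((1 - 4 * x) * (1 + 2 * x)\<^sup>2)"
    by (intro fps_cong_mult fps_cong_refl)
  moreover have "u ^ q = u * (u ^ ((q - 1) div 2))\<^sup>2"
    using \<open>odd q\<close> by (simp add: mult.commute flip: power_mult power_Suc)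
  then have "u ^ q * (1 + 2 * x)\<^sup>2 = u * Y\<^sup>2"
    by (simp only: Y_def power_mult_distrib mult.assoc)
  moreover have "(1 - 4 * x) * (1 + 2 * x)\<^sup>2 = 1 + fps_X ^ (2 * q) * (- 12 - 16 * x)"
  proof -
    have "(1 - 4 * x) * (1 + 2 * x)\<^sup>2 = 1 + x\<^sup>2 * (- 12 - 16 * x)"
      by (simp add: power2_eq_square algebra_simps)
    also have "x\<^sup>2 = fps_X ^ (2 * q)"
      by (simp add: x_def mult.commute flip: power_mult)
    finally show ?thesis .
  qed
  moreover have "fps_cong (int p) (2 * q) (1 + fps_X ^ (2 * q) * (- 12 - 16 * x)) (1 + 0)"
    by (intro fps_cong_add fps_cong_refl fps_cong_X_power_mult) simp
  moreover have "u * central_fps\<^sup>2 = 1"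
    unfolding u_def by (rule central_fps_square)
  ultimately have "fps_cong (int p) (2 * q) (u * central_fps\<^sup>2) (u * Y\<^sup>2)"
    by (simp only: add_0_right) (rule fps_cong_sym, rule fps_cong_trans)
  moreover have "u * central_fps\<^sup>2 - u * Y\<^sup>2 = (u * (central_fps + Y)) * (central_fps - Y)"
    by (simp add: power2_eq_square algebra_simps)
  ultimately have "fps_cong (int p) (2 * q) ((u * (central_fps + Y)) * (central_fps - Y)) 0"
    by (simp only: fps_cong_iff_diff[of _ _ "u * central_fps\<^sup>2"])
  \<comment> \<open>Both roots have constant term 1, so their sum has constant term 2, invertible
    because \<open>p\<close> is odd.\<close>
  moreover have "coprime ((u * (central_fps + Y)) $ 0) (int p)"
  proof -
    have "u $ 0 = 1" "x $ 0 = 0" "central_fps $ 0 = 1"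
      using \<open>q > 0\<close> by (auto simp: u_def x_def central_fps_def)
    then have "(u * (central_fps + Y)) $ 0 = 2"
      by (simp add: Y_def fps_nth_power_0)
    then show ?thesis
      using assms by simp
  qed
  ultimately have "fps_cong (int p) (2 * q) (central_fps - Y) 0"
    by (rule fps_cong_mult_cancel_left)
  then show ?thesis
    using fps_cong_iff_diff unfolding Y_def u_def x_def by blast
qed

section \<open>The full binomial series\<close>

text \<open>Up to order \<open>X^N\<close> this is \<open>1/(1-X) \<Sum>k (3k choose k) x^k\<close> with \<open>x = X^2/(1-X)^3\<close>.\<close>

definition binom_sum_fps :: "nat \<Rightarrow> int fps" where
  "binom_sum_fps N =
    (\<Sum>k<N. of_nat ((3 * k) choose k) * (fps_X ^ (2 * k) * geom_fps 1 (3 * k)))"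

text \<open>Coefficient \<open>n - 2k\<close> of \<open>1/(1-X)^(3k+1)\<close> is
  \<open>(n+k choose 3k)\<close>. Its product with \<open>(3k choose k)\<close> regroups as
  \<open>(n+k choose k) (n choose 2k)\<close>. The bound \<open>n < N\<close> ensures that every
  \<open>k\<close> with \<open>2k \<le> n\<close> occurs in the sum.\<close>

lemma binom_sum_fps_nth:
  assumes "n < N"
  shows "binom_sum_fps N $ n = (\<Sum>k | 2 * k \<le> n. int ((n choose (2 * k)) * ((n + k) choose k)))"
proof -
  have "binom_sum_fps N $ n =
    (\<Sum>k<N. if 2 * k \<le> n then int ((n choose (2 * k)) * ((n + k) choose k)) else 0)"
    unfolding binom_sum_fps_def fps_sum_nth
  proof (rule sum.cong[OF refl])
    fix k
    have "(of_nat ((3 * k) choose k) * (fps_X ^ (2 * k) * geom_fps 1 (3 * k))) $ n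
        = (if 2 * k \<le> n then int ((3 * k) choose k) * int ((3 * k + (n - 2 * k)) choose (3 * k)) else 0)"
      by (simp add: fps_of_nat[symmetric] fps_X_power_mult_nth geom_fps_def)
    also have "\<dots> = (if 2 * k \<le> n then int ((n choose (2 * k)) * ((n + k) choose k)) else 0)"
    proof (cases "2 * k \<le> n")
      case True
      then have "3 * k + (n - 2 * k) = n + k" by simp
      moreover have "((n + k) choose (3 * k)) * ((3 * k) choose k) = ((n + k) choose k) * (n choose (2 * k))"
        using choose_mult[of k "3 * k" "n + k"] True by simp
      ultimately show ?thesis
        using True by (simp add: add.commute mult.commute flip: of_nat_mult)
    qed simp
    finally show "(of_nat ((3 * k) choose k) * (fps_X ^ (2 * k) * geom_fps 1 (3 * k))) $ n
        = (if 2 * k \<le> n then int ((n choose (2 * k)) * ((n + k) choose k)) else 0)" .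
  qed
  also have "\<dots> = (\<Sum>k\<in>{k\<in>{..<N}. 2 * k \<le> n}. int ((n choose (2 * k)) * ((n + k) choose k)))"
    by (rule sum.inter_filter[symmetric]) simp
  also have "{k\<in>{..<N}. 2 * k \<le> n} = {k. 2 * k \<le> n}"
    using assms by auto
  finally show ?thesis .
qed

text \<open>Multiplication by \<open>4 + 2X\<close> produces the left side of the recurrence in each
  positive degree. The summand 1 accounts for degree 0, where \<open>4 = 1 + 3\<close>. Below
  \<open>X^N\<close> the coefficients are in fact equal.\<close>

lemma binom_sum_fps_cong:
  "fps_cong p N (2 * (2 + fps_X) * binom_sum_fps N) (1 + 3 * central_fps)"
proof -
  let ?B = "binom_sum_fps N"
  have "2 * (2 + fps_X) * F = 4 * F + 2 * (fps_X * F)" for F :: "int fps"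
    by (simp add: distrib_left distrib_right mult.assoc)
  then have nth: "(2 * (2 + fps_X) * F) $ 0 = 4 * F $ 0"
    "(2 * (2 + fps_X) * F) $ Suc n = 4 * F $ Suc n + 2 * F $ n"
    "(1 + 3 * F) $ 0 = 1 + 3 * F $ 0"
    "(1 + 3 * F) $ Suc n = 3 * F $ Suc n" for n and F :: "int fps"
    by (simp_all add: numeral_fps_const)
  have "(2 * (2 + fps_X) * ?B) $ n = (1 + 3 * central_fps) $ n" if "n < N" for n
  proof (cases n)
    case 0
    then show ?thesis
      using binom_sum_fps_nth[OF that] unfolding 0 nth by (simp add: central_fps_def)
  next
    case (Suc n')
    have n': "n' < N" using that Suc by simp
    show ?thesis
      unfolding Suc nth binom_sum_fps_nth[OF that[unfolded Suc]] binom_sum_fps_nth[OF n']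
        sum_choose_choose_recurrence
      by (simp only: central_fps_def fps_nth_Abs_fps)
  qed
  then show ?thesis
    by (simp add: fps_cong_def)
qed

section \<open>The truncated sum as a polynomial: low coefficients and degree\<close>

text \<open>This is \<open>(1-c)^(N-1)\<close> times the truncated sum with the denominators of
  \<open>x^k\<close> cleared. For \<open>3 * k < N\<close> the natural subtraction in the exponent
  is exact.\<close>

definition trunc_sum_poly :: "nat \<Rightarrow> int poly" where
  "trunc_sum_poly N = (\<Sum>k | 3 * k < N.
     of_nat ((3 * k) choose k) * ([:0, 1:] ^ (2 * k) * (1 - [:0, 1:]) ^ (N - 1 - 3 * k)))"

text \<open>Compare with \<open>(1-X)^(mq)\<close> times the full series, term by term: for
  \<open>3k < mq\<close> the terms are equal, for \<open>mq \<le> 3k\<close> and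
  \<open>2k < mq\<close> the binomial coefficient vanishes modulo \<open>p\<close>, and for
  \<open>mq \<le> 2k\<close> the factor \<open>X^(2k)\<close> exceeds the precision. Frobenius then
  rewrites \<open>(1-X)^(mq)\<close>.\<close>

lemma fps_of_poly_trunc_sum_cong:
  fixes p f m :: nat
  assumes "prime p" "m \<le> 2"
  defines "q \<equiv> p ^ f"
  shows "fps_cong (int p) (m * q) (fps_of_poly (trunc_sum_poly (m * q)))
    ((1 - fps_X ^ q) ^ m * binom_sum_fps (m * q))"
proof -
  let ?N = "m * q"
  let ?b = "\<lambda>k. of_nat ((3 * k) choose k) :: int fps"
  have of_nat: "fps_of_poly (of_nat n) = of_nat n" for n
    by (simp add: of_nat_poly fps_of_poly_const fps_of_nat)
  have "fps_of_poly (trunc_sum_poly ?N) =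
    (\<Sum>k\<in>{k\<in>{..<?N}. 3 * k < ?N}. ?b k * (fps_X ^ (2 * k) * (1 - fps_X) ^ (?N - 1 - 3 * k)))"
    unfolding trunc_sum_poly_def fps_of_poly_sum fps_of_poly_mult fps_of_poly_power fps_of_poly_diff
      fps_of_poly_fps_X fps_of_poly_1 of_nat
    by (rule sum.cong) auto
  also have "\<dots> = (\<Sum>k<?N. if 3 * k < ?N
      then ?b k * (fps_X ^ (2 * k) * (1 - fps_X) ^ (?N - 1 - 3 * k)) else 0)"
    by (rule sum.inter_filter) simp
  also have "fps_cong (int p) ?N \<dots>
      (\<Sum>k<?N. (1 - fps_X) ^ ?N * (?b k * (fps_X ^ (2 * k) * geom_fps 1 (3 * k))))"
  proof (rule fps_cong_sum)
    fix k
    consider "3 * k < ?N" | "?N \<le> 3 * k" "2 * k < ?N" | "?N \<le> 2 * k" by linarith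
    then show "fps_cong (int p) ?N
        (if 3 * k < ?N then ?b k * (fps_X ^ (2 * k) * (1 - fps_X) ^ (?N - 1 - 3 * k)) else 0)
        ((1 - fps_X) ^ ?N * (?b k * (fps_X ^ (2 * k) * geom_fps 1 (3 * k))))"
    proof cases
      case 1
      then have "?N = (?N - 1 - 3 * k) + Suc (3 * k)" by simp
      then have "(1 - fps_X :: int fps) ^ ?N = (1 - fps_X) ^ (?N - 1 - 3 * k) * (1 - fps_X) ^ Suc (3 * k)"
        by (metis power_add)
      moreover have "(1 - fps_X) ^ Suc (3 * k) * geom_fps 1 (3 * k) = 1"
        using geom_fps_mult[of 1 "3 * k"] by simp
      moreover have ring: "W * Z * (b * (Y * G)) = b * (Y * W) * (Z * G)" for W Z b Y G :: "int fps"
        by (simp only: mult_ac)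
      ultimately have "(1 - fps_X) ^ ?N * (?b k * (fps_X ^ (2 * k) * geom_fps 1 (3 * k)))
          = ?b k * (fps_X ^ (2 * k) * (1 - fps_X) ^ (?N - 1 - 3 * k))"
        by (simp only: mult_1_right ring)
      then show ?thesis
        using 1 by (simp only: if_True fps_cong_refl)
    next
      case 2
      \<comment> \<open>Here \<open>2k < mq \<le> 2q\<close> by \<open>m \<le> 2\<close>, and the
        remainder \<open>3k - mq\<close> is below \<open>k\<close> because
        \<open>2k < mq\<close>.\<close>
      have "k < q"
        using 2(2) mult_le_mono1[OF assms(2), of q] by linarith
      moreover have "3 * k - ?N < k" "3 * k = ?N + (3 * k - ?N)"
        using 2 by auto
      ultimately have "p dvd ((3 * k) choose k)"
        using prime_dvd_choose_of_remainder_less[OF assms(1), of "3 * k - ?N" k f m]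
        unfolding q_def by simp
      then have "fps_cong (int p) ?N (?b k) 0"
        by (auto simp: fps_cong_def cong_0_iff fps_of_nat[symmetric] int_dvd_int_iff)
      then have "fps_cong (int p) ?N (?b k * ((1 - fps_X) ^ ?N * (fps_X ^ (2 * k) * geom_fps 1 (3 * k))))
          (0 * ((1 - fps_X) ^ ?N * (fps_X ^ (2 * k) * geom_fps 1 (3 * k))))"
        by (intro fps_cong_mult fps_cong_refl)
      then show ?thesis
        using 2 by (simp add: fps_cong_sym mult.left_commute)
    next
      case 3
      then have "fps_cong (int p) ?N (fps_X ^ (2 * k) * ((1 - fps_X) ^ ?N * (?b k * geom_fps 1 (3 * k)))) 0"
        by (rule fps_cong_X_power_mult)
      then show ?thesis
        using 3 by (simp add: fps_cong_sym mult.left_commute)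
    qed
  qed
  also have "\<dots> = (1 - fps_X) ^ ?N * binom_sum_fps ?N"
    by (simp add: binom_sum_fps_def sum_distrib_left)
  also have "fps_cong (int p) ?N \<dots> ((1 - fps_X ^ q) ^ m * binom_sum_fps ?N)"
  proof (rule fps_cong_mult[OF _ fps_cong_refl])
    have minus_1: "1 + fps_const (- 1) * F = 1 - F" for F :: "int fps"
      by (simp flip: fps_const_neg)
    have "fps_cong (int p) ?N ((1 - fps_X) ^ q) (1 - fps_X ^ q)"
      using fps_cong_linear_prime_power[OF assms(1), of ?N "- 1" f] unfolding minus_1 q_def .
    from fps_cong_power[OF this, of m] show "fps_cong (int p) ?N ((1 - fps_X) ^ ?N) ((1 - fps_X ^ q) ^ m)"
      by (simp add: mult.commute flip: power_mult)
  qed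
  finally show ?thesis .
qed

lemma degree_trunc_sum_poly: "degree (trunc_sum_poly N) \<le> N - 1"
  unfolding trunc_sum_poly_def
proof (rule degree_sum_le)
  have "{k. 3 * k < N} \<subseteq> {..<N}" by auto
  then show "finite {k. 3 * k < N}" by (rule finite_subset) simp
  fix k assume "k \<in> {k. 3 * k < N}"
  then have k: "3 * k < N" by simp
  have "degree ([:0, 1:] ^ (2 * k) :: int poly) \<le> 2 * k"
    by (metis degree_linear_power order_refl)
  moreover have "degree ((1 - [:0, 1:] :: int poly) ^ (N - 1 - 3 * k)) \<le> N - 1 - 3 * k"
    using degree_power_le[of "1 - [:0, 1:] :: int poly" "N - 1 - 3 * k"] by (simp add: one_pCons)
  moreover have "degree (of_nat ((3 * k) choose k) :: int poly) = 0"
    by (simp add: of_nat_poly)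
  ultimately show "degree (of_nat ((3 * k) choose k) *
      ([:0, 1:] ^ (2 * k) * (1 - [:0, 1:] :: int poly) ^ (N - 1 - 3 * k))) \<le> N - 1"
    using k degree_mult_le[of "of_nat ((3 * k) choose k)" "[:0, 1:] ^ (2 * k) * (1 - [:0, 1:] :: int poly) ^ (N - 1 - 3 * k)"]
      degree_mult_le[of "[:0, 1:] ^ (2 * k) :: int poly" "(1 - [:0, 1:]) ^ (N - 1 - 3 * k)"]
    by linarith
qed

section \<open>Divisibility in Z[c] and passage to rational functions\<close>

text \<open>Only the coefficient of degree \<open>N\<close> is not covered by the congruence. Modulo
  \<open>p\<close> the value at \<open>a\<close> reduces to that coefficient times
  \<open>a ^ N\<close>, and \<open>a\<close> is invertible.\<close>

lemma const_dvd_of_fps_cong: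
  fixes D :: "int poly"
  assumes "fps_cong p N (fps_of_poly D) 0" "degree D \<le> N" "p dvd poly D a" "coprime a p"
  shows "[:p:] dvd D"
proof -
  have low: "p dvd Polynomial.coeff D i" if "i < N" for i
    using assms(1) that by (simp add: fps_cong_def cong_0_iff)
  have "p dvd Polynomial.coeff D N"
  proof (cases "degree D = N")
    case True
    have "poly D a = (\<Sum>i<N. Polynomial.coeff D i * a ^ i) + Polynomial.coeff D N * a ^ N"
      unfolding poly_altdef True by (simp add: lessThan_Suc_atMost[symmetric])
    moreover have "p dvd (\<Sum>i<N. Polynomial.coeff D i * a ^ i)"
      using low by (intro dvd_sum dvd_mult2) auto
    ultimately have "p dvd Polynomial.coeff D N * a ^ N"
      using assms(3) by (simp add: dvd_add_right_iff)
    then show ?thesis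
      using assms(4) by (simp add: coprime_commute coprime_dvd_mult_left_iff)
  next
    case False
    then show ?thesis
      using assms(2) by (simp add: coeff_eq_0)
  qed
  moreover have "Polynomial.coeff D i = 0" if "i > N" for i
    using that assms(2) by (simp add: coeff_eq_0)
  ultimately show ?thesis
    using low by (metis const_poly_dvd_iff dvd_0_right linorder_neqE_nat)
qed


lemma to_fract_power: "to_fract (a ^ n) = to_fract a ^ n"
  by (induction n) simp_all

lemma to_fract_of_nat: "to_fract (of_nat n) = of_nat n"
  by (induction n) simp_all

lemma to_fract_numeral: "to_fract (numeral w) = numeral w"
  by (metis to_fract_of_nat of_nat_numeral)

lemma to_fract_trunc_sum_poly:
  assumes "x = indet ^ 2 / (1 - indet) ^ 3"
  shows "to_fract (2 * (2 + [:0, 1:]) * trunc_sum_poly N) =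
    2 * (2 + indet) * (1 - indet) ^ (N - 1) *
      (\<Sum>k | 3 * k < N. of_nat ((3 * k) choose k) * x ^ k)"
proof -
  \<comment> \<open>Nonvanishing of \<open>1 - c\<close> permits cancelling
    \<open>(1-c)^(3k)\<close> against the denominator of \<open>x^k\<close>.\<close>
  have nz: "1 - indet \<noteq> (0 :: int poly fract)"
    by (simp add: indet_def one_pCons flip: to_fract_1 to_fract_diff)
  have x: "indet ^ (2 * k) * (1 - indet) ^ (N - 1 - 3 * k) = (1 - indet) ^ (N - 1) * x ^ k"
    if "3 * k < N" for k
  proof -
    have "N - 1 = (N - 1 - 3 * k) + 3 * k"
      using that by simp
    then have "(1 - indet) ^ (N - 1) = (1 - indet) ^ (N - 1 - 3 * k) * (1 - indet) ^ (3 * k)"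
      by (metis power_add)
    then show ?thesis
      using nz by (simp add: assms power_divide power_mult[symmetric])
  qed
  have "to_fract (trunc_sum_poly N) = (\<Sum>k | 3 * k < N.
      of_nat ((3 * k) choose k) * (indet ^ (2 * k) * (1 - indet) ^ (N - 1 - 3 * k)))"
    by (simp only: trunc_sum_poly_def to_fract_sum to_fract_mult to_fract_power to_fract_of_nat
        to_fract_diff to_fract_1 indet_def)
  also have "\<dots> = (1 - indet) ^ (N - 1) * (\<Sum>k | 3 * k < N. of_nat ((3 * k) choose k) * x ^ k)"
    unfolding sum_distrib_left
  proof (rule sum.cong[OF refl])
    fix k assume "k \<in> {k. 3 * k < N}"
    then have "3 * k < N" by simp
    show "of_nat ((3 * k) choose k) * (indet ^ (2 * k) * (1 - indet) ^ (N - 1 - 3 * k)) =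
        (1 - indet) ^ (N - 1) * (of_nat ((3 * k) choose k) * x ^ k)"
      unfolding x[OF \<open>3 * k < N\<close>] by (rule mult.left_commute)
  qed
  finally show ?thesis
    by (simp only: to_fract_mult to_fract_add to_fract_numeral indet_def mult.assoc)
qed

section \<open>The two congruences\<close>

text \<open>Common to \<open>m = 1\<close> and \<open>m = 2\<close>: what remains for the right side
  \<open>Q\<close> is a degree bound, its value at -2, and its coefficients below degree
  \<open>mq\<close>.\<close>

lemma poly_cong_trunc_sum:
  fixes p f m :: nat and Q :: "int poly"
  defines "q \<equiv> p ^ f"
  assumes "prime p" "odd p" "m \<in> {1, 2}"
    and Q: "degree Q \<le> m * q" "[poly Q (- 2) = 0] (mod int p)"
      "fps_cong (int p) (m * q) ((1 - fps_X ^ q) ^ m * (1 + 3 * central_fps)) (fps_of_poly Q)"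
    and x: "x = indet ^ 2 / (1 - indet) ^ 3"
  shows "poly_cong p (2 * (2 + indet) * (1 - indet) ^ (m * q - 1) *
      (\<Sum>k | 3 * k < m * q. of_nat ((3 * k) choose k) * x ^ k)) (to_fract Q)"
proof -
  let ?N = "m * q"
  let ?P = "2 * (2 + [:0, 1:]) * trunc_sum_poly ?N"
  have "?N > 0"
    using assms by (auto simp: prime_gt_0_nat)
  have "fps_cong (int p) ?N (2 * (2 + fps_X) * fps_of_poly (trunc_sum_poly ?N))
      (2 * (2 + fps_X) * ((1 - fps_X ^ q) ^ m * binom_sum_fps ?N))"
    using assms unfolding q_def
    by (intro fps_cong_mult fps_cong_refl fps_of_poly_trunc_sum_cong) auto
  also have "\<dots> = (1 - fps_X ^ q) ^ m * (2 * (2 + fps_X) * binom_sum_fps ?N)"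
    by (simp only: mult_ac)
  also have "fps_cong (int p) ?N \<dots> ((1 - fps_X ^ q) ^ m * (1 + 3 * central_fps))"
    by (intro fps_cong_mult fps_cong_refl binom_sum_fps_cong)
  also note Q(3)
  also have "2 * (2 + fps_X) * fps_of_poly (trunc_sum_poly ?N) = fps_of_poly ?P"
    by (simp only: fps_of_poly_mult fps_of_poly_add fps_of_poly_numeral fps_of_poly_fps_X)
  finally have "fps_cong (int p) ?N (fps_of_poly (?P - Q)) 0"
    unfolding fps_of_poly_diff using fps_cong_iff_diff by blast
  moreover have "degree (?P - Q) \<le> ?N"
  proof (rule degree_diff_le)
    have "2 * (2 + [:0, 1:]) = ([:4, 2:] :: int poly)"
      by (simp add: numeral_poly)
    then have "degree ?P \<le> 1 + degree (trunc_sum_poly ?N)"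
      using degree_mult_le[of "[:4, 2:]" "trunc_sum_poly ?N"] by simp
    then show "degree ?P \<le> ?N"
      using degree_trunc_sum_poly[of ?N] \<open>?N > 0\<close> by linarith
  qed (rule Q(1))
  \<comment> \<open>The factor \<open>2 + c\<close> makes \<open>?P\<close> vanish at -2 whatever
    the sum is.\<close>
  moreover have "int p dvd poly (?P - Q) (- 2)"
    using Q(2) by (simp add: cong_0_iff)
  moreover have "coprime (- 2) (int p)"
    using assms by simp
  ultimately have "[:int p:] dvd ?P - Q"
    by (rule const_dvd_of_fps_cong)
  then show ?thesis
    unfolding poly_cong_def to_fract_trunc_sum_poly[OF x, symmetric] by blast
qed

text \<open>At \<open>c = -2\<close> the base \<open>1 - 4c\<close> is \<open>9 = 3^2\<close>. The
  extra factor 3 completes the power to \<open>3^q\<close>, so the congruence also holds for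
  \<open>p = 3\<close>.\<close>

lemma three_times_nine_power_cong:
  fixes p f :: nat
  assumes "prime p" "odd p"
  shows "[3 * 9 ^ ((p ^ f - 1) div 2) = 3] (mod int p)"
proof -
  have "Suc (2 * ((p ^ f - 1) div 2)) = p ^ f"
    using assms by simp
  then have "3 * (3 ^ 2) ^ ((p ^ f - 1) div 2) = (3 :: int) ^ (p ^ f)"
    by (simp only: flip: power_mult power_Suc)
  then show ?thesis
    using fermat_prime_power[OF assms(1), of 3 f] by simp
qed

lemma degree_linear_power_le: "degree ((1 - 4 * [:0, 1:] :: int poly) ^ h) \<le> h"
proof -
  have "1 - 4 * [:0, 1:] = ([:1, - 4:] :: int poly)"
    by (simp add: numeral_poly one_pCons)
  then show ?thesis
    using degree_power_le[of "[:1, - 4:] :: int poly" h] by simp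
qed

theorem corollary4:
  fixes p f q :: nat and c x :: "int poly fract"
  assumes "prime p" and "odd p" and "f \<ge> 1" and "q = p ^ f"
    and "c = indet" and "x = c ^ 2 / (1 - c) ^ 3"
  shows "poly_cong p
           (2 * (2 + c) * (1 - c) ^ (q - 1) *
              (\<Sum>k | real k < real q / 3. of_nat ((3 * k) choose k) * x ^ k))
           (1 + 3 * (1 - 4 * c) ^ ((q - 1) div 2) + 2 * c ^ q)
       \<and> poly_cong p
           (2 * (2 + c) * (1 - c) ^ (2 * q - 1) *
              (\<Sum>k | real k < 2 * real q / 3. of_nat ((3 * k) choose k) * x ^ k))
           (1 + 3 * (1 - 4 * c) ^ ((q - 1) div 2) - 2 * c ^ q - 2 * c ^ (2 * q))"
proof
  let ?h = "(q - 1) div 2"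
  let ?v = "(1 - 4 * [:0, 1:]) ^ ?h :: int poly"
  let ?V = "(1 - 4 * fps_X) ^ ?h :: int fps"
  let ?X = "fps_X ^ q :: int fps"
  have x: "x = indet ^ 2 / (1 - indet) ^ 3"
    using assms by simp
  have central: "fps_cong (int p) (2 * q) central_fps (?V * (1 + 2 * ?X))"
    using central_fps_cong[OF assms(1,2), of f] assms(4) by simp
  have two: "[(- 2) ^ q = - 2] (mod int p)"
    using fermat_prime_power[OF assms(1)] assms(4) by simp
  have v_at: "[3 * poly ?v (- 2) = 3] (mod int p)"
    using three_times_nine_power_cong[OF assms(1,2), of f] assms(4) by simp
  have deg_v: "degree (3 * ?v) \<le> q"
  proof -
    have "degree (3 * ?v) \<le> degree (3 :: int poly) + degree ?v"
      by (rule degree_mult_le)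
    moreover have "degree (3 :: int poly) = 0" "?h \<le> q"
      by simp_all
    ultimately show ?thesis
      using degree_linear_power_le[of ?h] by linarith
  qed
  have deg_X: "degree (2 * [:0, 1:] ^ n :: int poly) \<le> n" for n
    using degree_mult_le[of "2 :: int poly" "[:0, 1:] ^ n"] by (simp add: degree_linear_power)
  have "poly_cong p (2 * (2 + indet) * (1 - indet) ^ (1 * q - 1) *
      (\<Sum>k | 3 * k < 1 * q. of_nat ((3 * k) choose k) * x ^ k))
      (to_fract (1 + 3 * ?v + 2 * [:0, 1:] ^ q))"
    unfolding assms(4)
  proof (rule poly_cong_trunc_sum, unfold assms(4)[symmetric])
    show "degree (1 + 3 * ?v + 2 * [:0, 1:] ^ q) \<le> 1 * q"
      using deg_v deg_X[of q] by (intro degree_add_le) simp_all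
    have "[1 + 3 * poly ?v (- 2) + 2 * (- 2) ^ q = 1 + 3 + 2 * (- 2)] (mod int p)"
      using two v_at by (intro cong_add cong_mult cong_refl)
    then show "[poly (1 + 3 * ?v + 2 * [:0, 1:] ^ q) (- 2) = 0] (mod int p)"
      by simp
    have "fps_cong (int p) (1 * q) ((1 - ?X) ^ 1 * (1 + 3 * central_fps))
        ((1 - ?X) ^ 1 * (1 + 3 * (?V * (1 + 2 * ?X))))"
      using fps_cong_mono[OF central, of "1 * q"] by (intro fps_cong_mult fps_cong_add fps_cong_refl) simp
    also have "fps_cong (int p) (1 * q) \<dots> (1 + 3 * ?V + 2 * ?X)"
    \<comment> \<open>Modulo \<open>X^q\<close> only \<open>1 + 3V\<close> is visible; the term
      \<open>2 c^q\<close> is fixed by the vanishing at -2 just checked,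
      \<open>1 + 3 - 4 = 0\<close>.\<close>
    proof -
      have "(1 - y) ^ 1 * (1 + 3 * (V * (1 + 2 * y))) - (1 + 3 * V + 2 * y)
          = y * (3 * V - 6 * V * y - 3)" for V y :: "int fps"
        by (simp add: algebra_simps)
      then show ?thesis
        by (subst fps_cong_iff_diff) (simp only: fps_cong_X_power_mult mult_1 order_refl)
    qed
    finally show "fps_cong (int p) (1 * q) ((1 - ?X) ^ 1 * (1 + 3 * central_fps))
        (fps_of_poly (1 + 3 * ?v + 2 * [:0, 1:] ^ q))"
      by (simp only: fps_of_poly_add fps_of_poly_diff fps_of_poly_mult fps_of_poly_power
          fps_of_poly_numeral fps_of_poly_fps_X fps_of_poly_1)
  qed (use assms x in simp_all)
  moreover have "{k. real k < real q / 3} = {k. 3 * k < 1 * q}"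
    by auto
  ultimately show "poly_cong p (2 * (2 + c) * (1 - c) ^ (q - 1) *
      (\<Sum>k | real k < real q / 3. of_nat ((3 * k) choose k) * x ^ k))
      (1 + 3 * (1 - 4 * c) ^ ?h + 2 * c ^ q)"
    by (simp only: assms(5) indet_def mult_1 to_fract_add to_fract_diff to_fract_mult to_fract_power
        to_fract_numeral to_fract_1)
  have "poly_cong p (2 * (2 + indet) * (1 - indet) ^ (2 * q - 1) *
      (\<Sum>k | 3 * k < 2 * q. of_nat ((3 * k) choose k) * x ^ k))
      (to_fract (1 + 3 * ?v - 2 * [:0, 1:] ^ q - 2 * [:0, 1:] ^ (2 * q)))"
    unfolding assms(4)
  proof (rule poly_cong_trunc_sum, unfold assms(4)[symmetric])
    show "degree (1 + 3 * ?v - 2 * [:0, 1:] ^ q - 2 * [:0, 1:] ^ (2 * q)) \<le> 2 * q"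
      using deg_v deg_X[of q] deg_X[of "2 * q"] by (intro degree_add_le degree_diff_le) simp_all
    have "[1 + 3 * poly ?v (- 2) - 2 * (- 2) ^ q - 2 * ((- 2) ^ q) ^ 2
        = 1 + 3 - 2 * (- 2) - 2 * (- 2) ^ 2] (mod int p)"
      using two v_at by (intro cong_add cong_diff cong_mult cong_refl cong_pow)
    then show "[poly (1 + 3 * ?v - 2 * [:0, 1:] ^ q - 2 * [:0, 1:] ^ (2 * q)) (- 2) = 0] (mod int p)"
      by (simp add: mult.commute[of 2 q] power_mult)
    have "fps_cong (int p) (2 * q) ((1 - ?X) ^ 2 * (1 + 3 * central_fps))
        ((1 - ?X) ^ 2 * (1 + 3 * (?V * (1 + 2 * ?X))))"
      using central by (intro fps_cong_mult fps_cong_add fps_cong_refl)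
    also have "fps_cong (int p) (2 * q) \<dots> (1 + 3 * ?V - 2 * ?X - 2 * fps_X ^ (2 * q))"
    \<comment> \<open>The terms \<open>6 V X^q\<close> and \<open>-6 V X^q\<close> cancel, leaving
      \<open>-2 X^q\<close>. The term \<open>-2 c^(2q)\<close> is invisible modulo
      \<open>X^(2q)\<close> and fixed by the vanishing at -2,
      \<open>1 + 3 + 4 - 8 = 0\<close>.\<close>
    proof -
      have "(1 - y) ^ 2 * (1 + 3 * (V * (1 + 2 * y))) - (1 + 3 * V - 2 * y - 2 * y ^ 2)
          = y ^ 2 * (3 - 9 * V + 6 * V * y)" for V y :: "int fps"
        by (simp add: power2_eq_square algebra_simps)
      note eq = this[of ?X ?V, folded power_mult, unfolded mult.commute[of q 2]]
      show ?thesis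
        by (subst fps_cong_iff_diff) (simp only: eq fps_cong_X_power_mult order_refl)
    qed
    finally show "fps_cong (int p) (2 * q) ((1 - ?X) ^ 2 * (1 + 3 * central_fps))
        (fps_of_poly (1 + 3 * ?v - 2 * [:0, 1:] ^ q - 2 * [:0, 1:] ^ (2 * q)))"
      by (simp only: fps_of_poly_add fps_of_poly_diff fps_of_poly_mult
          fps_of_poly_power fps_of_poly_numeral fps_of_poly_fps_X fps_of_poly_1)
  qed (use assms x in simp_all)
  moreover have "{k. real k < 2 * real q / 3} = {k. 3 * k < 2 * q}"
    by auto
  ultimately show "poly_cong p (2 * (2 + c) * (1 - c) ^ (2 * q - 1) *
      (\<Sum>k | real k < 2 * real q / 3. of_nat ((3 * k) choose k) * x ^ k))
      (1 + 3 * (1 - 4 * c) ^ ?h - 2 * c ^ q - 2 * c ^ (2 * q))"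
    by (simp only: assms(5) indet_def to_fract_add to_fract_diff to_fract_mult to_fract_power
        to_fract_numeral to_fract_1)
qed

end
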